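(* Assume the joint distribution function of $(U_{k,l,t})_{l,t}$ is continuous. Fix $\epsilon>0$, and let $\delta(\epsilon)>0$ be a number $\delta>0$ such that $$\Pr\Big(\max_{l,t}\{U_{k,l,t}-v_{l,t}+v_{-k}\}\geq 0\Big)\le \epsilon+\Pr\Big(\max_{l,t}\{U_{k,l,t}-v_{l,t}+v_{-k}-\delta\}\geq 0\Big).$$ Consider the pricing strategy $$p_{k,l,t}=v_{l,t}-v_{-k}+\delta(\epsilon)\qquad (l\in\{1,\dots,L\},\ t\in\{t_k+1,\dots,T\}).$$ Then this pricing strategy maximizes the ex-post social welfare with probability at least $1-\epsilon$; that is, with probability at least $1-\epsilon$ over the realization $(u_{k,l,t})_{l,t}$ of $(U_{k,l,t})_{l,t}$, it maximizes $\sum_{l,t}(u_{k,l,t}-v_{l,t}+v_{-k})A_{k,l,t}(\mathbf p_k)$ over all price menus $\mathbf p_k=(p_{k,l,t})_{l,t}$ with $p_{k,l,t}\ge0$.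
   Context: Contracts and user. User $k$ arrives at a charging station at time $t_k<T$ (discrete time, horizon $T$). A contract is a pair $(l,t)$ with energy level $l\in\{1,\dots,L\}$ and deadline $t\in\{t_k+1,\dots,T\}$. The station posts a price $p_{k,l,t}\ge 0$ for every contract; $\mathbf p_k=(p_{k,l,t})_{l,t}$ (the value $+\infty$ is allowed; a contract with infinite price is never accepted, and its terms in all sums are read as $0$). User $k$ has real utility $u_{k,l,t}$ for contract $(l,t)$, the realization of a random variable $U_{k,l,t}$ (the $U_{k,l,t}$ have some joint distribution, not necessarily independent), and utility $0$ if it rejects all contracts. The user knows its realized utilities; the station does not. Given $\mathbf p_k$ the user is a price taker and chooses $A_{k,l,t}(\mathbf p_k)\in[0,1]$ to maximize $\sum_{l,t}A_{k,l,t}(u_{k,l,t}-p_{k,l,t})$ subject to $\sum_{l,t}A_{k,l,t}\le 1$: it chooses a contract (or any convex combination of contracts) attaining the maximal payoff $\max_{i,j}(u_{k,i,j}-p_{k,i,j})$ if this maximum is $\ge 0$ (ties between charging and not charging are resolved in favour of charging, so then $\sum_{l,t} A_{k,l,t}=1$), and all $A_{k,l,t}=0$ if the maximum is negative. Costs. $\mathcal K_0$ is the set of users already present at time $t_k$; user $i\in\mathcal K_0$ has deadline $w_i$ and remaining demand $N_i$. Known data: conventional energy prices $c_t\ge0$, harvested energies $\bar E^t\ge 0$, maximal charging rate $R_{max}$, battery capacity $B_{max}$, initial battery level $B_0\in[0,B_{max}]$. For a contract $(l,d)$, $v_{l,d}$ is the optimal value of the linear program: minimize $\sum_{t=t_k}^{T-1}c_tq_t$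 over nonnegative variables $r_{k,t},q_{k,t},r_{i,t},q_{i,t}\ (i\in\mathcal K_0),\,q_t,r_t,D_t$ (for $t_k\le t\le T-1$) and battery levels $B^t$, subject to (a) $\sum_{t=t_k}^{d-1}(r_{k,t}+q_{k,t})\ge l$; (b) $\sum_{t=t_k}^{w_i-1}(r_{i,t}+q_{i,t})\ge N_i$ for all $i\in\mathcal K_0$; (c) $r_{k,t}+q_{k,t}\le R_{max}$ and $r_{i,t}+q_{i,t}\le R_{max}$ for all $i\in\mathcal K_0$ and all $t$; (d) $r_{k,t}+\sum_{i\in\mathcal K_0}r_{i,t}=r_t$ and $q_{k,t}+\sum_{i\in\mathcal K_0}q_{i,t}\le q_t$ for all $t$; (e) $B^{t+1}=B^t+\bar E^t-r_t+q_t-q_{k,t}-\sum_{i\in\mathcal K_0}q_{i,t}-D_t$, $0\le B^{t+1}\le B_{max}$, $B^{t_k}=B_0$, $B^T=B_0$. If the program is infeasible, $v_{l,d}=\infty$. $v_{-k}$ is the optimal value of the same program with $r_{k,t}=q_{k,t}=0$ for all $t$ and constraint (a) dropped (the cost of serving only the existing users), assumed finite. These costs do not depend on the prices, and $v_{l,t}-v_{-k}\ge 0$. Social welfare is the sum of the user surplus and the station's profit, i.e. $\sum_{l,t}(u_{k,l,t}-v_{l,t}+v_{-k})A_{k,l,t}(\mathbf p_k)$. *)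

theory Defs
  imports "HOL-Probability.Probability"
begin

text \<open>Time is discrete, and contracts are pairs (energy level, deadline).  Costs, prices and
  payoffs live in \<^typ>\<open>ereal\<close>; since \<^prop>\<open>(x::ereal) * 0 = 0\<close> also for infinite \<open>x\<close>, contracts
  that are not accepted contribute \<open>0\<close> to every sum below, whatever their price or cost.\<close>

type_synonym contract = "nat \<times> nat"

record 'i station =
  arrival :: nat
  horizon :: nat
  levels :: nat
  present :: "'i set"
  deadline :: "'i \<Rightarrow> nat"
  demand :: "'i \<Rightarrow> real"
  conv_price :: "nat \<Rightarrow> real"
  harvest :: "nat \<Rightarrow> real"
  max_rate :: real
  capacity :: real
  init_battery :: real

definition slots :: "'i station \<Rightarrow> nat set" where
  "slots S = {arrival S..<horizon S}"

definition contracts :: "'i station \<Rightarrow> contract set" where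
  "contracts S = {1..levels S} \<times> {arrival S + 1..horizon S}"

text \<open>The deadlines of the present users are only required not to exceed the horizon, so that the
  energy delivered before a deadline involves only slots at which variables are constrained.\<close>

definition valid_station :: "'i station \<Rightarrow> bool" where
  "valid_station S \<longleftrightarrow>
     arrival S < horizon S \<and> 1 \<le> levels S \<and>
     finite (present S) \<and> (\<forall>i\<in>present S. deadline S i \<le> horizon S) \<and>
     (\<forall>t\<in>slots S. 0 \<le> conv_price S t \<and> 0 \<le> harvest S t) \<and>
     0 \<le> init_battery S \<and> init_battery S \<le> capacity S"


subsection \<open>Serving costs\<close>

text \<open>Variables of the linear program: \<open>r\<close> stands for renewable and \<open>q\<close> for conventional energy,
  given to the arriving user, to a present user, or in total.  Only their values at
  \<open>slots S\<close> (for the battery: up to the horizon) and at present users matter.\<close>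

record 'i schedule =
  r_new :: "nat \<Rightarrow> real"
  q_new :: "nat \<Rightarrow> real"
  r_old :: "'i \<Rightarrow> nat \<Rightarrow> real"
  q_old :: "'i \<Rightarrow> nat \<Rightarrow> real"
  r_tot :: "nat \<Rightarrow> real"
  q_tot :: "nat \<Rightarrow> real"
  dump :: "nat \<Rightarrow> real"
  battery :: "nat \<Rightarrow> real"

definition nonneg_schedule :: "'i station \<Rightarrow> 'i schedule \<Rightarrow> bool" where
  "nonneg_schedule S x \<longleftrightarrow>
     (\<forall>t\<in>slots S. 0 \<le> r_new x t \<and> 0 \<le> q_new x t \<and>
        (\<forall>i\<in>present S. 0 \<le> r_old x i t \<and> 0 \<le> q_old x i t) \<and>
        0 \<le> r_tot x t \<and> 0 \<le> q_tot x t \<and> 0 \<le> dump x t)"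

definition serves_new :: "'i station \<Rightarrow> 'i schedule \<Rightarrow> contract \<Rightarrow> bool" where
  "serves_new S x = (\<lambda>(l, d). (\<Sum>t\<in>{arrival S..<d}. r_new x t + q_new x t) \<ge> real l)"

definition serves_present :: "'i station \<Rightarrow> 'i schedule \<Rightarrow> bool" where
  "serves_present S x \<longleftrightarrow>
     (\<forall>i\<in>present S.
        (\<Sum>t\<in>{arrival S..<deadline S i}. r_old x i t + q_old x i t) \<ge> demand S i)"

definition rate_limited :: "'i station \<Rightarrow> 'i schedule \<Rightarrow> bool" where
  "rate_limited S x \<longleftrightarrow>
     (\<forall>t\<in>slots S. r_new x t + q_new x t \<le> max_rate S \<and>
        (\<forall>i\<in>present S. r_old x i t + q_old x i t \<le> max_rate S))"

definition energy_balanced :: "'i station \<Rightarrow> 'i schedule \<Rightarrow> bool" where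
  "energy_balanced S x \<longleftrightarrow>
     (\<forall>t\<in>slots S. r_new x t + (\<Sum>i\<in>present S. r_old x i t) = r_tot x t \<and>
        q_new x t + (\<Sum>i\<in>present S. q_old x i t) \<le> q_tot x t)"

definition battery_dynamics :: "'i station \<Rightarrow> 'i schedule \<Rightarrow> bool" where
  "battery_dynamics S x \<longleftrightarrow>
     (\<forall>t\<in>slots S.
        battery x (t + 1) = battery x t + harvest S t - r_tot x t + q_tot x t - q_new x t
          - (\<Sum>i\<in>present S. q_old x i t) - dump x t \<and>
        0 \<le> battery x (t + 1) \<and> battery x (t + 1) \<le> capacity S) \<and>
     battery x (arrival S) = init_battery S \<and> battery x (horizon S) = init_battery S"

definition operable :: "'i station \<Rightarrow> 'i schedule \<Rightarrow> bool" where
  "operable S x \<longleftrightarrow>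
     nonneg_schedule S x \<and> serves_present S x \<and> rate_limited S x \<and>
     energy_balanced S x \<and> battery_dynamics S x"

definition energy_cost :: "'i station \<Rightarrow> 'i schedule \<Rightarrow> real" where
  "energy_cost S x = (\<Sum>t\<in>slots S. conv_price S t * q_tot x t)"

text \<open>Optimal values are infima in \<^typ>\<open>ereal\<close>, hence \<open>\<infinity>\<close> for an infeasible program.\<close>

definition cost_with :: "'i station \<Rightarrow> contract \<Rightarrow> ereal" where
  "cost_with S c = (INF x\<in>{x. operable S x \<and> serves_new S x c}. ereal (energy_cost S x))"

definition cost_without :: "'i station \<Rightarrow> ereal" where
  "cost_without S =
     (INF x\<in>{x. operable S x \<and> (\<forall>t\<in>slots S. r_new x t = 0 \<and> q_new x t = 0)}.
        ereal (energy_cost S x))"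


subsection \<open>User behaviour and social welfare\<close>

definition price_menu :: "'i station \<Rightarrow> (contract \<Rightarrow> ereal) \<Rightarrow> bool" where
  "price_menu S p \<longleftrightarrow> (\<forall>c\<in>contracts S. 0 \<le> p c)"

definition choice :: "'i station \<Rightarrow> (contract \<Rightarrow> real) \<Rightarrow> bool" where
  "choice S a \<longleftrightarrow> (\<forall>c\<in>contracts S. 0 \<le> a c \<and> a c \<le> 1) \<and> (\<Sum>c\<in>contracts S. a c) \<le> 1"

definition user_surplus ::
    "'i station \<Rightarrow> (contract \<Rightarrow> real) \<Rightarrow> (contract \<Rightarrow> ereal) \<Rightarrow> (contract \<Rightarrow> real) \<Rightarrow> ereal" where
  "user_surplus S u p a = (\<Sum>c\<in>contracts S. ereal (a c) * (ereal (u c) - p c))"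

definition max_payoff ::
    "'i station \<Rightarrow> (contract \<Rightarrow> real) \<Rightarrow> (contract \<Rightarrow> ereal) \<Rightarrow> ereal" where
  "max_payoff S u p = Max ((\<lambda>c. ereal (u c) - p c) ` contracts S)"

text \<open>A positive weight on an infinitely priced contract makes the surplus \<open>-\<infinity>\<close>, so such contracts
  are never accepted.  The last two conjuncts fix the choice of a user who is indifferent
  between charging and not charging; how ties between contracts are broken is left open.\<close>

definition user_response ::
    "'i station \<Rightarrow> (contract \<Rightarrow> real) \<Rightarrow> (contract \<Rightarrow> ereal) \<Rightarrow> (contract \<Rightarrow> real) \<Rightarrow> bool" where
  "user_response S u p a \<longleftrightarrow>
     is_arg_max (user_surplus S u p) (choice S) a \<and>
     (0 \<le> max_payoff S u p \<longrightarrow> (\<Sum>c\<in>contracts S. a c) = 1) \<and>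
     (max_payoff S u p < 0 \<longrightarrow> (\<forall>c\<in>contracts S. a c = 0))"

definition social_welfare ::
    "'i station \<Rightarrow> (contract \<Rightarrow> real) \<Rightarrow> (contract \<Rightarrow> real) \<Rightarrow> ereal" where
  "social_welfare S u a =
     (\<Sum>c\<in>contracts S. (ereal (u c) - cost_with S c + cost_without S) * ereal (a c))"


subsection \<open>Joint distribution function\<close>

definition joint_cdf ::
    "'w measure \<Rightarrow> 'c set \<Rightarrow> ('c \<Rightarrow> 'w \<Rightarrow> real) \<Rightarrow> ('c \<Rightarrow> real) \<Rightarrow> real" where
  "joint_cdf M C U x = measure M {\<omega> \<in> space M. \<forall>c\<in>C. U c \<omega> \<le> x c}"

end

theory Submission
  imports Defs
begin

text \<open>Write \<open>W\<close> for the largest social surplus \<open>u c - v c + v0\<close> of a single contract, where \<open>v\<close> and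
  \<open>v0\<close> are the costs with and without the arriving user.  Welfare is a subconvex combination of
  these surpluses, so no menu yields more than \<open>max 0 W\<close>.  A menu that charges the marginal cost
  \<open>v c - v0\<close> plus a uniform markup \<open>s\<close> shifts every payoff of the user to the social surplus
  minus \<open>s\<close>; hence the user ranks contracts as the planner does, and the markup only influences
  whether he charges at all.  He buys when \<open>W \<ge> s\<close>, which yields the welfare \<open>W\<close>, and otherwise
  leaves, which yields \<open>0\<close> (\<open>social_welfare_markup_accepted\<close>, \<open>social_welfare_markup_rejected\<close>).

  For \<open>s > 0\<close> the menu therefore fails to be optimal exactly when \<open>0 < W < s\<close>: the menu without
  markup then does better (\<open>markup_menu_optimal_iff\<close>).  Since this characterises the optimality
  event exactly, whatever the tie-breaking of the user, the event is measurable even if \<open>M\<close> is not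
  complete.  The condition on \<open>\<delta>\<close> says that \<open>0 \<le> W < \<delta>\<close> has probability at most \<open>\<epsilon>\<close>.

  Marginal-cost prices form a menu because they are nonnegative: a schedule that serves the
  arriving user still works without him if his energy is thrown away
  (\<open>cost_without_le_cost_with\<close>).\<close>

section \<open>Marginal serving costs\<close>

lemma finite_contracts: "finite (contracts S)"
  by (simp add: contracts_def)

lemma contracts_nonempty: "valid_station S \<Longrightarrow> contracts S \<noteq> {}"
  by (auto simp: contracts_def valid_station_def)

lemma energy_cost_nonneg:
  assumes "valid_station S" "operable S x"
  shows "0 \<le> energy_cost S x"
  using assms unfolding energy_cost_def valid_station_def operable_def nonneg_schedule_def
  by (intro sum_nonneg) auto

lemma cost_without_nonneg: "valid_station S \<Longrightarrow> 0 \<le> cost_without S"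
  unfolding cost_without_def by (intro INF_greatest) (auto intro: energy_cost_nonneg)

text \<open>The energy meant for the arriving user is redirected to the free disposal \<open>dump\<close>; the
  purchased amounts, and with them the cost and the battery levels, stay the same.\<close>

lemma cost_without_le_cost_with: "cost_without S \<le> cost_with S c"
  unfolding cost_with_def
proof (rule INF_greatest)
  fix x assume "x \<in> {x. operable S x \<and> serves_new S x c}"
  then have x: "operable S x" by simp
  define y where "y = x\<lparr>r_new := \<lambda>_. 0, q_new := \<lambda>_. 0,
    r_tot := \<lambda>t. r_tot x t - r_new x t, dump := \<lambda>t. dump x t + r_new x t + q_new x t\<rparr>"
  have "0 \<le> (\<Sum>i\<in>present S. r_old x i t)" if "t \<in> slots S" for t
    using x that by (intro sum_nonneg) (auto simp: operable_def nonneg_schedule_def)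
  then have "r_new x t \<le> r_tot x t" if "t \<in> slots S" for t
    using x that by (fastforce simp: operable_def energy_balanced_def)
  then have "nonneg_schedule S y"
    using x by (simp add: operable_def nonneg_schedule_def y_def)
  moreover have "rate_limited S y"
    using x unfolding operable_def nonneg_schedule_def rate_limited_def y_def
    by (force intro: order_trans)
  moreover have "energy_balanced S y"
    using x unfolding operable_def nonneg_schedule_def energy_balanced_def y_def
    by (force simp: algebra_simps)
  moreover have "serves_present S y"
    using x by (simp add: operable_def serves_present_def y_def)
  moreover have "battery_dynamics S y"
    using x by (auto simp: operable_def battery_dynamics_def y_def)
  ultimately have "operable S y" by (simp add: operable_def)
  moreover have "energy_cost S y = energy_cost S x"
    by (simp add: energy_cost_def y_def)
  ultimately show "cost_without S \<le> ereal (energy_cost S x)"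
    unfolding cost_without_def
    by (intro INF_lower2[of y]) (auto simp: y_def)
qed

lemma serving_costs_cases:
  assumes "valid_station S" "cost_without S \<noteq> \<infinity>"
  obtains v0 where "cost_without S = ereal v0" "0 \<le> v0"
    "\<And>c. cost_with S c = \<infinity> \<or> (\<exists>v\<ge>v0. cost_with S c = ereal v)"
proof -
  obtain v0 where v0: "cost_without S = ereal v0" "0 \<le> v0"
    using cost_without_nonneg[OF assms(1)] assms(2) by (cases "cost_without S") auto
  have "cost_with S c = \<infinity> \<or> (\<exists>v\<ge>v0. cost_with S c = ereal v)" for c
    using cost_without_le_cost_with[of S c] v0 by (cases "cost_with S c") auto
  with v0 show thesis by (rule that)
qed


section \<open>Welfare under marginal-cost prices with a uniform markup\<close>

definition contract_surplus :: "'i station \<Rightarrow> (contract \<Rightarrow> real) \<Rightarrow> contract \<Rightarrow> ereal" where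
  "contract_surplus S u c = ereal (u c) - cost_with S c + cost_without S"

definition max_surplus :: "'i station \<Rightarrow> (contract \<Rightarrow> real) \<Rightarrow> ereal" where
  "max_surplus S u = Max (contract_surplus S u ` contracts S)"

definition markup_menu :: "'i station \<Rightarrow> real \<Rightarrow> contract \<Rightarrow> ereal" where
  "markup_menu S s c = cost_with S c - cost_without S + ereal s"

lemma markup_menu_price_menu:
  assumes "valid_station S" "cost_without S \<noteq> \<infinity>" "0 \<le> s"
  shows "price_menu S (markup_menu S s)"
proof -
  obtain v0 where v: "cost_without S = ereal v0"
    "\<And>c. cost_with S c = \<infinity> \<or> (\<exists>v\<ge>v0. cost_with S c = ereal v)"
    using serving_costs_cases[OF assms(1,2)] by metis
  show ?thesis
    unfolding price_menu_def
  proof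
    fix c
    show "0 \<le> markup_menu S s c"
      using v(2)[of c] assms(3) by (auto simp: markup_menu_def v(1))
  qed
qed

lemma payoff_markup_menu:
  assumes "valid_station S" "cost_without S \<noteq> \<infinity>"
  shows "ereal (u c) - markup_menu S s c = contract_surplus S u c - ereal s"
proof -
  obtain v0 where v: "cost_without S = ereal v0"
    "\<And>c. cost_with S c = \<infinity> \<or> (\<exists>v\<ge>v0. cost_with S c = ereal v)"
    using serving_costs_cases[OF assms] by metis
  show ?thesis
    using v(2)[of c] by (auto simp: markup_menu_def contract_surplus_def v(1))
qed

lemma contract_surplus_not_PInf:
  assumes "valid_station S" "cost_without S \<noteq> \<infinity>"
  shows "contract_surplus S u c \<noteq> \<infinity>"
proof -
  obtain v0 where v: "cost_without S = ereal v0"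
    "\<And>c. cost_with S c = \<infinity> \<or> (\<exists>v\<ge>v0. cost_with S c = ereal v)"
    using serving_costs_cases[OF assms] by metis
  show ?thesis
    using v(2)[of c] by (auto simp: contract_surplus_def v(1))
qed

lemma contract_surplus_le_max_surplus:
  "c \<in> contracts S \<Longrightarrow> contract_surplus S u c \<le> max_surplus S u"
  by (simp add: max_surplus_def finite_contracts)

lemma max_surplus_attained:
  assumes "valid_station S"
  obtains c where "c \<in> contracts S" "contract_surplus S u c = max_surplus S u"
proof -
  have "max_surplus S u \<in> contract_surplus S u ` contracts S"
    unfolding max_surplus_def
    by (intro Max_in) (simp_all add: finite_contracts contracts_nonempty[OF assms])
  with that show thesis by auto
qed

lemma max_payoff_markup_nonneg_iff:
  assumes "valid_station S" "cost_without S \<noteq> \<infinity>"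
  shows "0 \<le> max_payoff S u (markup_menu S s) \<longleftrightarrow> ereal s \<le> max_surplus S u"
  unfolding max_payoff_def max_surplus_def payoff_markup_menu[OF assms]
  by (subst (1 2) Max_ge_iff)
     (auto simp: finite_contracts contracts_nonempty[OF assms(1)] ereal_le_minus)

lemma social_welfare_le_max_surplus:
  assumes "choice S a"
  shows "social_welfare S u a \<le> max 0 (max_surplus S u)"
proof -
  let ?m = "max 0 (max_surplus S u)"
  have "social_welfare S u a \<le> (\<Sum>c\<in>contracts S. ?m * ereal (a c))"
    unfolding social_welfare_def contract_surplus_def[symmetric]
    using assms
    by (intro sum_mono ereal_mult_right_mono)
       (auto simp: choice_def le_max_iff_disj contract_surplus_le_max_surplus)
  also have "\<dots> = ?m * (\<Sum>c\<in>contracts S. ereal (a c))"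
    using assms by (intro sum_ereal_right_distrib[symmetric]) (auto simp: choice_def)
  also have "\<dots> \<le> ?m * 1"
    using assms by (intro ereal_mult_left_mono) (auto simp: choice_def)
  finally show ?thesis by simp
qed

text \<open>The markup that the user pays is a transfer to the station, hence it separates his surplus
  from welfare.  The identity also covers a weight on an infinitely expensive contract, which
  makes both sides \<open>-\<infinity>\<close>.\<close>

lemma social_welfare_markup_menu:
  assumes "valid_station S" "cost_without S \<noteq> \<infinity>" "choice S a"
  shows "social_welfare S u a =
    user_surplus S u (markup_menu S s) a + ereal (s * (\<Sum>c\<in>contracts S. a c))"
proof -
  have "contract_surplus S u c * ereal (a c) =
      ereal (a c) * (contract_surplus S u c - ereal s) + ereal (s * a c)"
    if "c \<in> contracts S" for c
    using contract_surplus_not_PInf[OF assms(1,2), of u c] assms(3) that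
    by (cases "contract_surplus S u c"; cases "a c = 0")
       (auto simp: choice_def algebra_simps)
  then have "social_welfare S u a = (\<Sum>c\<in>contracts S.
      ereal (a c) * (contract_surplus S u c - ereal s) + ereal (s * a c))"
    unfolding social_welfare_def contract_surplus_def[symmetric] by (intro sum.cong) auto
  also have "\<dots> = user_surplus S u (markup_menu S s) a + ereal (s * (\<Sum>c\<in>contracts S. a c))"
    by (simp add: user_surplus_def payoff_markup_menu[OF assms(1,2)] sum.distrib
        sum_distrib_left)
  finally show ?thesis .
qed

text \<open>Putting all weight on a contract with the largest social surplus \<open>W\<close> would give the user
  \<open>W - s\<close>, so his actual choice gives him at least as much, and the station receives the
  markup \<open>s\<close> on top.\<close>

lemma social_welfare_markup_accepted:
  assumes "valid_station S" "cost_without S \<noteq> \<infinity>"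
    and resp: "user_response S u (markup_menu S s) a"
    and "ereal s \<le> max_surplus S u" and "0 \<le> s"
  shows "social_welfare S u a = max_surplus S u"
proof (rule antisym)
  have a: "choice S a" and a1: "(\<Sum>c\<in>contracts S. a c) = 1"
    and opt: "\<And>b. choice S b \<Longrightarrow>
      user_surplus S u (markup_menu S s) b \<le> user_surplus S u (markup_menu S s) a"
    using resp max_payoff_markup_nonneg_iff[OF assms(1,2)] assms(4)
    by (auto simp: user_response_def is_arg_max_linorder)
  obtain c where c: "c \<in> contracts S" "contract_surplus S u c = max_surplus S u"
    by (rule max_surplus_attained[OF assms(1)])
  have fin: "\<bar>max_surplus S u\<bar> \<noteq> \<infinity>"
    using contract_surplus_not_PInf[OF assms(1,2), of u c] c(2) assms(4)
    by (cases "max_surplus S u") auto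
  let ?b = "\<lambda>c'. if c' = c then 1 else 0 :: real"
  have "choice S ?b"
    using c(1) by (simp add: choice_def finite_contracts)
  moreover have "user_surplus S u (markup_menu S s) ?b = max_surplus S u - ereal s"
    using c by (simp add: user_surplus_def payoff_markup_menu[OF assms(1,2)] finite_contracts
        if_distrib[of ereal] if_distribR zero_ereal_def[symmetric] one_ereal_def[symmetric]
        if_distrib[of "\<lambda>x. x * _"] cong: if_cong)
  ultimately have "max_surplus S u - ereal s \<le> user_surplus S u (markup_menu S s) a"
    using opt by metis
  then have "max_surplus S u - ereal s + ereal s \<le> social_welfare S u a"
    unfolding social_welfare_markup_menu[OF assms(1,2) a, of u s] a1
    by (intro add_mono) simp_all
  then show "max_surplus S u \<le> social_welfare S u a"
    using fin by (cases "max_surplus S u") auto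
  show "social_welfare S u a \<le> max_surplus S u"
    using social_welfare_le_max_surplus[OF a, of u] order_trans[OF _ assms(4), of 0] assms(5)
    by (simp add: max_def)
qed

lemma social_welfare_markup_rejected:
  assumes "valid_station S" "cost_without S \<noteq> \<infinity>"
    and "user_response S u (markup_menu S s) a"
    and "max_surplus S u < ereal s"
  shows "social_welfare S u a = 0"
  using assms(3,4) max_payoff_markup_nonneg_iff[OF assms(1,2), of u s]
  by (auto simp: user_response_def social_welfare_def zero_ereal_def[symmetric] not_le
      intro!: sum.neutral)

lemma markup_menu_optimal_iff:
  assumes "valid_station S" "cost_without S \<noteq> \<infinity>"
    and resp: "\<And>p. price_menu S p \<Longrightarrow> user_response S u p (B p)"
    and s: "0 < s"
  shows "is_arg_max (\<lambda>p. social_welfare S u (B p)) (price_menu S) (markup_menu S s) \<longleftrightarrow>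
    max_surplus S u \<le> 0 \<or> ereal s \<le> max_surplus S u"
proof -
  let ?w = "\<lambda>p. social_welfare S u (B p)"
  have menu: "price_menu S (markup_menu S r)" if "0 \<le> r" for r
    using markup_menu_price_menu[OF assms(1,2) that] .
  have bound: "?w p \<le> max 0 (max_surplus S u)" if "price_menu S p" for p
    using resp[OF that]
    by (intro social_welfare_le_max_surplus) (auto simp: user_response_def is_arg_max_linorder)
  have accepted: "?w (markup_menu S r) = max_surplus S u"
    if "0 \<le> r" "ereal r \<le> max_surplus S u" for r
    using social_welfare_markup_accepted[OF assms(1,2) resp[OF menu] that(2,1)] that(1) by simp
  have rejected: "?w (markup_menu S s) = 0" if "max_surplus S u < ereal s"
    using social_welfare_markup_rejected[OF assms(1,2) resp[OF menu] that] s by simp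
  show ?thesis
  proof (cases "ereal s \<le> max_surplus S u")
    case True
    moreover have "0 \<le> max_surplus S u"
      using True s by (metis ereal_less(2) less_imp_le order_trans)
    ultimately show ?thesis
      using accepted[of s] bound menu[of s] s by (auto simp: is_arg_max_linorder max_def)
  next
    case False
    then have r: "?w (markup_menu S s) = 0" using rejected by simp
    show ?thesis
    proof (cases "max_surplus S u \<le> 0")
      case True
      then show ?thesis
        using r bound menu[of s] s by (auto simp: is_arg_max_linorder max_absorb1)
    next
      case pos: False
      then have "?w (markup_menu S s) < ?w (markup_menu S 0)"
        using accepted[of 0] r by (simp add: zero_ereal_def[symmetric] not_le less_imp_le)
      then have "\<not> is_arg_max ?w (price_menu S) (markup_menu S s)"
        using menu[of 0] by (auto simp: is_arg_max_def)
      then show ?thesis using pos False by simp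
    qed
  qed
qed


section \<open>The probability of an ex-post optimal menu\<close>

lemma max_surplus_measurable:
  assumes "\<And>c. c \<in> contracts S \<Longrightarrow> U c \<in> borel_measurable M"
  shows "(\<lambda>\<omega>. max_surplus S (\<lambda>c. U c \<omega>)) \<in> borel_measurable M"
  unfolding max_surplus_def contract_surplus_def
  using assms by (intro borel_measurable_Max finite_contracts borel_measurable_ereal_add
      borel_measurable_ereal_diff borel_measurable_ereal) simp_all

theorem theorem5:
  fixes S :: "'i station"
    and M :: "'w measure"
    and U :: "contract \<Rightarrow> 'w \<Rightarrow> real"
    and A :: "(contract \<Rightarrow> real) \<Rightarrow> (contract \<Rightarrow> ereal) \<Rightarrow> contract \<Rightarrow> real"
    and \<epsilon> \<delta> :: real
  assumes "valid_station S"
    and "cost_without S \<noteq> \<infinity>"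
    and "prob_space M"
    and "\<And>c. c \<in> contracts S \<Longrightarrow> U c \<in> borel_measurable M"
    and "continuous_map (powertop_real (contracts S)) euclideanreal
           (joint_cdf M (contracts S) U)"
    and "\<And>u p. price_menu S p \<Longrightarrow> user_response S u p (A u p)"
    and "\<epsilon> > 0"
    and "\<delta> > 0"
    and "measure M {\<omega> \<in> space M.
             Max ((\<lambda>c. ereal (U c \<omega>) - cost_with S c + cost_without S) ` contracts S) \<ge> 0}
         \<le> \<epsilon> + measure M {\<omega> \<in> space M.
             Max ((\<lambda>c. ereal (U c \<omega>) - cost_with S c + cost_without S - ereal \<delta>)
                  ` contracts S) \<ge> 0}"
  shows "measure M {\<omega> \<in> space M.
           is_arg_max (\<lambda>p. social_welfare S (\<lambda>c. U c \<omega>) (A (\<lambda>c. U c \<omega>) p)) (price_menu S)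
             (\<lambda>c. cost_with S c - cost_without S + ereal \<delta>)}
         \<ge> 1 - \<epsilon>"
proof -
  interpret prob_space M by fact
  define W where "W \<omega> = max_surplus S (\<lambda>c. U c \<omega>)" for \<omega>
  have [measurable]: "W \<in> borel_measurable M"
    unfolding W_def by (rule max_surplus_measurable[OF assms(4)])
  have "Max ((\<lambda>c. ereal (U c \<omega>) - cost_with S c + cost_without S) ` contracts S) = W \<omega>" for \<omega>
    by (simp add: W_def max_surplus_def contract_surplus_def)
  moreover have "Max ((\<lambda>c. ereal (U c \<omega>) - cost_with S c + cost_without S - ereal \<delta>)
      ` contracts S) \<ge> 0 \<longleftrightarrow> ereal \<delta> \<le> W \<omega>" for \<omega>
    using max_payoff_markup_nonneg_iff[OF assms(1,2), of "\<lambda>c. U c \<omega>" \<delta>]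
    unfolding max_payoff_def W_def
      payoff_markup_menu[OF assms(1,2), where u = "\<lambda>c. U c \<omega>"] contract_surplus_def .
  ultimately have delta: "prob {\<omega> \<in> space M. 0 \<le> W \<omega>} \<le> \<epsilon> + prob {\<omega> \<in> space M. ereal \<delta> \<le> W \<omega>}"
    using assms(9) by simp
  have "1 - prob {\<omega> \<in> space M. 0 \<le> W \<omega>} = prob {\<omega> \<in> space M. W \<omega> < 0}"
    by (subst prob_compl[symmetric]) (auto intro!: arg_cong[where f = prob])
  with delta have "1 - \<epsilon> \<le> prob {\<omega> \<in> space M. W \<omega> < 0} + prob {\<omega> \<in> space M. ereal \<delta> \<le> W \<omega>}"
    by simp
  also have "\<dots> = prob ({\<omega> \<in> space M. W \<omega> < 0} \<union> {\<omega> \<in> space M. ereal \<delta> \<le> W \<omega>})"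
  proof (rule finite_measure_Union[symmetric])
    have "\<not> (x < 0 \<and> ereal \<delta> \<le> x)" for x
      using assms(8) by (cases x) auto
    then show "{\<omega> \<in> space M. W \<omega> < 0} \<inter> {\<omega> \<in> space M. ereal \<delta> \<le> W \<omega>} = {}"
      by blast
  qed measurable
  also have "\<dots> \<le> prob {\<omega> \<in> space M. W \<omega> \<le> 0 \<or> ereal \<delta> \<le> W \<omega>}"
    by (rule finite_measure_mono) auto
  also have "{\<omega> \<in> space M. W \<omega> \<le> 0 \<or> ereal \<delta> \<le> W \<omega>} = {\<omega> \<in> space M.
      is_arg_max (\<lambda>p. social_welfare S (\<lambda>c. U c \<omega>) (A (\<lambda>c. U c \<omega>) p)) (price_menu S)
        (\<lambda>c. cost_with S c - cost_without S + ereal \<delta>)}"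
    using markup_menu_optimal_iff[OF assms(1,2,6) assms(8)]
    by (simp add: W_def markup_menu_def[abs_def])
  finally show ?thesis .
qed

end
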